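(* Let $k$ be a commutative ring with identity and $(A,\cdot)$ a pre-Lie $k$-algebra. The category of modules over the pre-Lie $k$-algebra $(A,\cdot)$ and the category of modules over its sub-adjacent Lie $k$-algebra $(A,[-,-])$ are isomorphic.
   Context: A $k$-algebra is a $k$-module with a $k$-bilinear multiplication (not necessarily associative). A pre-Lie $k$-algebra is a $k$-algebra $(A,\cdot)$ with $(x\cdot y)\cdot z-x\cdot(y\cdot z)=(y\cdot x)\cdot z-y\cdot(x\cdot z)$ for all $x,y,z\in A$. Its sub-adjacent Lie algebra is $(A,[-,-])$ with $[x,y]=x\cdot y-y\cdot x$. A module over the pre-Lie algebra $(A,\cdot)$ is a $k$-module $M$ with a $k$-bilinear mapping $\cdot\colon A\times M\to M$ such that $(x\cdot y)\cdot m-x\cdot(y\cdot m)=(y\cdot x)\cdot m-y\cdot(x\cdot m)$ for all $x,y\in A$, $m\in M$; equivalently, a $k$-module $M$ with a pre-morphism $\lambda\colon(A,\cdot)\to(\operatorname{End}(_kM),\circ)$, i.e. a $k$-linear mapping with $\lambda(x\cdot y)-\lambda(x)\circ\lambda(y)=\lambda(y\cdot x)-\lambda(y)\circ\lambda(x)$ for all $x,y\in A$. A module over a Lie $k$-algebra $L$ is a $k$-module $M$ with a Lie $k$-algebra homomorphism $L\to\mathfrak{gl}(M)$, where $\mathfrak{gl}(M)$ is $\operatorname{End}(_kM)$ with bracket $[f,g]=f\circ g-g\circ f$. In both cases module morphisms are the $k$-linear mappings compatible with the actions. *)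

theory Defs
  imports "HOL-Algebra.Module"
begin

section \<open>Categories, functors, isomorphism of categories\<close>

record ('o, 'f) cat =
  Obj :: "'o set"
  Arr :: "'f set"
  Dom :: "'f \<Rightarrow> 'o"
  Cod :: "'f \<Rightarrow> 'o"
  Ident :: "'o \<Rightarrow> 'f"
  Comp :: "'f \<Rightarrow> 'f \<Rightarrow> 'f"  \<comment> \<open>\<open>Comp C g f\<close> is \<open>g\<close> after \<open>f\<close>\<close>

locale category =
  fixes C :: "('o, 'f) cat"
  assumes Dom_closed: "f \<in> Arr C \<Longrightarrow> Dom C f \<in> Obj C"
    and Cod_closed: "f \<in> Arr C \<Longrightarrow> Cod C f \<in> Obj C"
    and Ident_closed: "X \<in> Obj C \<Longrightarrow> Ident C X \<in> Arr C"
    and Dom_Ident: "X \<in> Obj C \<Longrightarrow> Dom C (Ident C X) = X"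
    and Cod_Ident: "X \<in> Obj C \<Longrightarrow> Cod C (Ident C X) = X"
    and Comp_closed:
      "\<lbrakk>f \<in> Arr C; g \<in> Arr C; Dom C g = Cod C f\<rbrakk> \<Longrightarrow> Comp C g f \<in> Arr C"
    and Dom_Comp:
      "\<lbrakk>f \<in> Arr C; g \<in> Arr C; Dom C g = Cod C f\<rbrakk> \<Longrightarrow> Dom C (Comp C g f) = Dom C f"
    and Cod_Comp:
      "\<lbrakk>f \<in> Arr C; g \<in> Arr C; Dom C g = Cod C f\<rbrakk> \<Longrightarrow> Cod C (Comp C g f) = Cod C g"
    and Comp_Ident_right: "f \<in> Arr C \<Longrightarrow> Comp C f (Ident C (Dom C f)) = f"
    and Comp_Ident_left: "f \<in> Arr C \<Longrightarrow> Comp C (Ident C (Cod C f)) f = f"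
    and Comp_assoc:
      "\<lbrakk>f \<in> Arr C; g \<in> Arr C; h \<in> Arr C; Dom C g = Cod C f; Dom C h = Cod C g\<rbrakk>
        \<Longrightarrow> Comp C h (Comp C g f) = Comp C (Comp C h g) f"

locale cat_functor = C: category C + D: category D
  for C :: "('o, 'f) cat" and D :: "('p, 'g) cat" +
  fixes Fo :: "'o \<Rightarrow> 'p" and Fa :: "'f \<Rightarrow> 'g"
  assumes Fo_closed: "X \<in> Obj C \<Longrightarrow> Fo X \<in> Obj D"
    and Fa_closed: "f \<in> Arr C \<Longrightarrow> Fa f \<in> Arr D"
    and Dom_Fa: "f \<in> Arr C \<Longrightarrow> Dom D (Fa f) = Fo (Dom C f)"
    and Cod_Fa: "f \<in> Arr C \<Longrightarrow> Cod D (Fa f) = Fo (Cod C f)"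
    and Fa_Ident: "X \<in> Obj C \<Longrightarrow> Fa (Ident C X) = Ident D (Fo X)"
    and Fa_Comp:
      "\<lbrakk>f \<in> Arr C; g \<in> Arr C; Dom C g = Cod C f\<rbrakk> \<Longrightarrow> Fa (Comp C g f) = Comp D (Fa g) (Fa f)"

definition isomorphic_categories :: "('o, 'f) cat \<Rightarrow> ('p, 'g) cat \<Rightarrow> bool" where
  "isomorphic_categories C D \<longleftrightarrow>
    (\<exists>Fo Fa Go Ga. cat_functor C D Fo Fa \<and> cat_functor D C Go Ga \<and>
      (\<forall>X\<in>Obj C. Go (Fo X) = X) \<and> (\<forall>f\<in>Arr C. Ga (Fa f) = f) \<and>
      (\<forall>Y\<in>Obj D. Fo (Go Y) = Y) \<and> (\<forall>g\<in>Arr D. Fa (Ga g) = g))"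


section \<open>Linear and bilinear maps\<close>

definition lin_maps ::
  "('k, 'r) ring_scheme \<Rightarrow> ('k, 'a, 's) module_scheme \<Rightarrow> ('k, 'b, 't) module_scheme \<Rightarrow> ('a \<Rightarrow> 'b) set"
  where "lin_maps R X Y = {f \<in> carrier X \<rightarrow> carrier Y.
    (\<forall>x\<in>carrier X. \<forall>y\<in>carrier X. f (x \<oplus>\<^bsub>X\<^esub> y) = f x \<oplus>\<^bsub>Y\<^esub> f y) \<and>
    (\<forall>a\<in>carrier R. \<forall>x\<in>carrier X. f (a \<odot>\<^bsub>X\<^esub> x) = a \<odot>\<^bsub>Y\<^esub> f x)}"

definition bilin_map ::
  "('k, 'r) ring_scheme \<Rightarrow> ('k, 'a, 's) module_scheme \<Rightarrow> ('k, 'b, 't) module_scheme \<Rightarrow>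
    ('k, 'c, 'u) module_scheme \<Rightarrow> ('a \<Rightarrow> 'b \<Rightarrow> 'c) \<Rightarrow> bool"
  where "bilin_map R X Y Z b \<longleftrightarrow>
    (\<forall>x\<in>carrier X. (\<lambda>y. b x y) \<in> lin_maps R Y Z) \<and>
    (\<forall>y\<in>carrier Y. (\<lambda>x. b x y) \<in> lin_maps R X Z)"


section \<open>Pre-Lie and Lie algebras\<close>

text \<open>The multiplication of a not necessarily associative algebra is the \<^const>\<open>mult\<close> field of
  its module record; the \<^const>\<open>one\<close> field plays no role.  For a Lie algebra \<^const>\<open>mult\<close> is the
  bracket.\<close>

locale nonassoc_algebra = module R A
  for R :: "('k, 'r) ring_scheme" and A :: "('k, 'a, 's) module_scheme" +
  assumes mult_bilin: "bilin_map R A A A (\<lambda>x y. x \<otimes>\<^bsub>A\<^esub> y)"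

locale pre_lie_algebra = nonassoc_algebra +
  assumes pre_lie:
    "\<lbrakk>x \<in> carrier A; y \<in> carrier A; z \<in> carrier A\<rbrakk> \<Longrightarrow>
      (x \<otimes>\<^bsub>A\<^esub> y) \<otimes>\<^bsub>A\<^esub> z \<ominus>\<^bsub>A\<^esub> x \<otimes>\<^bsub>A\<^esub> (y \<otimes>\<^bsub>A\<^esub> z) =
      (y \<otimes>\<^bsub>A\<^esub> x) \<otimes>\<^bsub>A\<^esub> z \<ominus>\<^bsub>A\<^esub> y \<otimes>\<^bsub>A\<^esub> (x \<otimes>\<^bsub>A\<^esub> z)"

locale lie_algebra = nonassoc_algebra R L
  for R :: "('k, 'r) ring_scheme" and L :: "('k, 'a, 's) module_scheme" +
  assumes alternating: "x \<in> carrier L \<Longrightarrow> x \<otimes>\<^bsub>L\<^esub> x = \<zero>\<^bsub>L\<^esub>"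
    and jacobi:
    "\<lbrakk>x \<in> carrier L; y \<in> carrier L; z \<in> carrier L\<rbrakk> \<Longrightarrow>
      x \<otimes>\<^bsub>L\<^esub> (y \<otimes>\<^bsub>L\<^esub> z) \<oplus>\<^bsub>L\<^esub> y \<otimes>\<^bsub>L\<^esub> (z \<otimes>\<^bsub>L\<^esub> x) \<oplus>\<^bsub>L\<^esub> z \<otimes>\<^bsub>L\<^esub> (x \<otimes>\<^bsub>L\<^esub> y) = \<zero>\<^bsub>L\<^esub>"

definition sub_adjacent :: "('k, 'a, 's) module_scheme \<Rightarrow> ('k, 'a, 's) module_scheme" where
  "sub_adjacent A = A\<lparr>mult := (\<lambda>x y. x \<otimes>\<^bsub>A\<^esub> y \<ominus>\<^bsub>A\<^esub> y \<otimes>\<^bsub>A\<^esub> x)\<rparr>"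

definition lie_hom ::
  "('k, 'r) ring_scheme \<Rightarrow> ('k, 'a, 's) module_scheme \<Rightarrow> ('k, 'b, 't) module_scheme \<Rightarrow> ('a \<Rightarrow> 'b) set"
  where "lie_hom R L L' = {h \<in> lin_maps R L L'.
    \<forall>x\<in>carrier L. \<forall>y\<in>carrier L. h (x \<otimes>\<^bsub>L\<^esub> y) = h x \<otimes>\<^bsub>L'\<^esub> h y}"

text \<open>Endomorphisms are \<^const>\<open>undefined\<close> outside the carrier, so that equality in
  \<open>End_alg R M\<close> is equality of maps on the carrier.\<close>

definition End_alg ::
  "('k, 'r) ring_scheme \<Rightarrow> ('k, 'm, 't) module_scheme \<Rightarrow> ('k, 'm \<Rightarrow> 'm) module"
  where "End_alg R M = \<lparr>
    carrier = lin_maps R M M \<inter> extensional (carrier M),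
    mult = (\<lambda>f g. compose (carrier M) f g),
    one = (\<lambda>x\<in>carrier M. x),
    zero = (\<lambda>x\<in>carrier M. \<zero>\<^bsub>M\<^esub>),
    add = (\<lambda>f g. \<lambda>x\<in>carrier M. f x \<oplus>\<^bsub>M\<^esub> g x),
    smult = (\<lambda>a f. \<lambda>x\<in>carrier M. a \<odot>\<^bsub>M\<^esub> f x)\<rparr>"

definition gl :: "('k, 'r) ring_scheme \<Rightarrow> ('k, 'm, 't) module_scheme \<Rightarrow> ('k, 'm \<Rightarrow> 'm) module"
  where "gl R M = sub_adjacent (End_alg R M)"


section \<open>Modules and their categories\<close>

locale pre_lie_module = pre_lie_algebra R A + M: module R M
  for R :: "('k, 'r) ring_scheme" and A :: "('k, 'a, 's) module_scheme"
    and M :: "('k, 'm, 't) module_scheme" +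
  fixes act :: "'a \<times> 'm \<Rightarrow> 'm"
  assumes act_bilin: "bilin_map R A M M (\<lambda>x m. act (x, m))"
    and act_pre_lie:
    "\<lbrakk>x \<in> carrier A; y \<in> carrier A; m \<in> carrier M\<rbrakk> \<Longrightarrow>
      act (x \<otimes>\<^bsub>A\<^esub> y, m) \<ominus>\<^bsub>M\<^esub> act (x, act (y, m)) =
      act (y \<otimes>\<^bsub>A\<^esub> x, m) \<ominus>\<^bsub>M\<^esub> act (y, act (x, m))"

locale lie_module = lie_algebra R L + M: module R M
  for R :: "('k, 'r) ring_scheme" and L :: "('k, 'a, 's) module_scheme"
    and M :: "('k, 'm, 't) module_scheme" +
  fixes \<rho> :: "'a \<Rightarrow> 'm \<Rightarrow> 'm"
  assumes rep_hom: "\<rho> \<in> lie_hom R L (gl R M)"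

text \<open>The modules with underlying set inside the type \<open>'m\<close>.  The record fields are normalised
  where the module structure does not determine them, so that each module occurs exactly once.\<close>

definition k_modules :: "('k, 'r) ring_scheme \<Rightarrow> ('k, 'm) module set" where
  "k_modules R = {M. module R M \<and>
    (\<lambda>(x, y). x \<oplus>\<^bsub>M\<^esub> y) \<in> extensional (carrier M \<times> carrier M) \<and>
    (\<lambda>(a, x). a \<odot>\<^bsub>M\<^esub> x) \<in> extensional (carrier R \<times> carrier M) \<and>
    mult M = (\<lambda>_ _. undefined) \<and> one M = undefined}"

type_synonym ('k, 'a, 'm) pl_obj = "('k, 'm) module \<times> ('a \<times> 'm \<Rightarrow> 'm)"
type_synonym ('k, 'a, 'm) lie_obj = "('k, 'm) module \<times> ('a \<Rightarrow> 'm \<Rightarrow> 'm)"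

text \<open>Arrows are triples of source, map and target.\<close>

type_synonym ('o, 'm) arrow = "'o \<times> ('m \<Rightarrow> 'm) \<times> 'o"

definition mk_cat ::
  "(('k, 'm) module \<times> 's) set \<Rightarrow>
    (('k, 'm) module \<times> 's \<Rightarrow> ('k, 'm) module \<times> 's \<Rightarrow> ('m \<Rightarrow> 'm) set) \<Rightarrow>
    (('k, 'm) module \<times> 's, (('k, 'm) module \<times> 's, 'm) arrow) cat"
  where "mk_cat Ob Hom = \<lparr>
    Obj = Ob,
    Arr = {(X, f, Y). X \<in> Ob \<and> Y \<in> Ob \<and> f \<in> Hom X Y},
    Dom = (\<lambda>(X, f, Y). X),
    Cod = (\<lambda>(X, f, Y). Y),
    Ident = (\<lambda>X. (X, \<lambda>m\<in>carrier (fst X). m, X)),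
    Comp = (\<lambda>(Y, g, Z) (X, f, Y'). (X, compose (carrier (fst X)) g f, Z))\<rparr>"

definition pre_lie_modules ::
  "('k, 'r) ring_scheme \<Rightarrow> ('k, 'a, 's) module_scheme \<Rightarrow> ('k, 'a, 'm) pl_obj set"
  where "pre_lie_modules R A = {(M, act). M \<in> k_modules R \<and> pre_lie_module R A M act \<and>
    act \<in> extensional (carrier A \<times> carrier M)}"

definition pre_lie_module_homs ::
  "('k, 'r) ring_scheme \<Rightarrow> ('k, 'a, 's) module_scheme \<Rightarrow>
    ('k, 'a, 'm) pl_obj \<Rightarrow> ('k, 'a, 'm) pl_obj \<Rightarrow> ('m \<Rightarrow> 'm) set"
  where "pre_lie_module_homs R A = (\<lambda>(M, act) (N, act').
    {f \<in> lin_maps R M N \<inter> extensional (carrier M).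
      \<forall>x\<in>carrier A. \<forall>m\<in>carrier M. f (act (x, m)) = act' (x, f m)})"

definition pre_lie_module_cat ::
  "('k, 'r) ring_scheme \<Rightarrow> ('k, 'a, 's) module_scheme \<Rightarrow>
    (('k, 'a, 'm) pl_obj, (('k, 'a, 'm) pl_obj, 'm) arrow) cat"
  where "pre_lie_module_cat R A = mk_cat (pre_lie_modules R A) (pre_lie_module_homs R A)"

definition lie_modules ::
  "('k, 'r) ring_scheme \<Rightarrow> ('k, 'a, 's) module_scheme \<Rightarrow> ('k, 'a, 'm) lie_obj set"
  where "lie_modules R L = {(M, \<rho>). M \<in> k_modules R \<and> lie_module R L M \<rho> \<and>
    \<rho> \<in> extensional (carrier L)}"

definition lie_module_homs ::
  "('k, 'r) ring_scheme \<Rightarrow> ('k, 'a, 's) module_scheme \<Rightarrow>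
    ('k, 'a, 'm) lie_obj \<Rightarrow> ('k, 'a, 'm) lie_obj \<Rightarrow> ('m \<Rightarrow> 'm) set"
  where "lie_module_homs R L = (\<lambda>(M, \<rho>) (N, \<rho>').
    {f \<in> lin_maps R M N \<inter> extensional (carrier M).
      \<forall>x\<in>carrier L. \<forall>m\<in>carrier M. f (\<rho> x m) = \<rho>' x (f m)})"

definition lie_module_cat ::
  "('k, 'r) ring_scheme \<Rightarrow> ('k, 'a, 's) module_scheme \<Rightarrow>
    (('k, 'a, 'm) lie_obj, (('k, 'a, 'm) lie_obj, 'm) arrow) cat"
  where "lie_module_cat R L = mk_cat (lie_modules R L) (lie_module_homs R L)"

end

theory Submission
  imports Defs
begin

text \<open>A bilinear action \<open>act\<close> of \<open>A\<close> on \<open>M\<close> is the same as a linear map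
  \<open>\<rho> x = act (x, -)\<close> into the endomorphisms of \<open>M\<close>, and moving two terms across the
  equality turns the module identity over the pre-Lie algebra into
  \<open>\<rho> (x y - y x) = \<rho> x \<rho> y - \<rho> y \<rho> x\<close>.  So currying is a bijection on objects, and it
  keeps the underlying \<open>k\<close>-module and the set of morphisms between two modules.\<close>

section \<open>Concrete categories\<close>

text \<open>Identities and composites in \<open>mk_cat\<close> are restricted to the carrier of the
  source, so the unit laws hold as equalities of functions because morphisms are extensional and
  preserve carriers. For associativity, \<open>f\<close> must map into the carrier on which the
  inner composite of \<open>h\<close> and \<open>g\<close> is defined.\<close>

lemma category_mk_cat:
  assumes maps: "\<And>X Y. Hom X Y \<subseteq> (carrier (fst X) \<rightarrow> carrier (fst Y)) \<inter> extensional (carrier (fst X))"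
    and ident: "\<And>X. X \<in> Ob \<Longrightarrow> (\<lambda>m\<in>carrier (fst X). m) \<in> Hom X X"
    and comp: "\<And>X Y Z f g. \<lbrakk>X \<in> Ob; Y \<in> Ob; Z \<in> Ob; f \<in> Hom X Y; g \<in> Hom Y Z\<rbrakk>
      \<Longrightarrow> compose (carrier (fst X)) g f \<in> Hom X Z"
  shows "category (mk_cat Ob Hom)"
proof -
  have id_right: "compose (carrier (fst X)) f (\<lambda>m\<in>carrier (fst X). m) = f"
    and id_left: "compose (carrier (fst X)) (\<lambda>m\<in>carrier (fst Y). m) f = f"
    if "f \<in> Hom X Y" for X Y f
    using that maps[of X Y] by (auto intro!: compose_Id Id_compose)
  have assoc: "compose (carrier (fst X)) h (compose (carrier (fst X)) g f)
      = compose (carrier (fst X)) (compose (carrier (fst Y)) h g) f"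
    if "f \<in> Hom X Y" for X Y f g h
    using that maps[of X Y] by (intro compose_assoc) auto
  show ?thesis
    by unfold_locales (auto simp: mk_cat_def intro: ident comp id_right id_left assoc)
qed

text \<open>The functor leaves underlying maps untouched. Since \<open>F\<close> keeps the first
  component, and with it the carrier used for restriction, identities and composites on the two
  sides coincide.\<close>

lemma cat_functor_mk_cat:
  assumes "category (mk_cat Ob Hom)" and "category (mk_cat Ob' Hom')"
    and "\<And>X. X \<in> Ob \<Longrightarrow> F X \<in> Ob'"
    and "\<And>X. fst (F X) = fst X"
    and "\<And>X Y. \<lbrakk>X \<in> Ob; Y \<in> Ob\<rbrakk> \<Longrightarrow> Hom X Y \<subseteq> Hom' (F X) (F Y)"
  shows "cat_functor (mk_cat Ob Hom) (mk_cat Ob' Hom') F (\<lambda>(X, f, Y). (F X, f, F Y))"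
proof -
  interpret C: category "mk_cat Ob Hom" by fact
  interpret D: category "mk_cat Ob' Hom'" by fact
  have "f \<in> Hom' (F X) (F Y)" if "X \<in> Ob" "Y \<in> Ob" "f \<in> Hom X Y" for X Y f
    using assms(5) that by blast
  then show ?thesis
    by unfold_locales (use assms(3,4) in \<open>auto simp: mk_cat_def\<close>)
qed

lemma isomorphic_categories_mk_cat:
  assumes "category (mk_cat Ob Hom)" and "category (mk_cat Ob' Hom')"
    and F: "\<And>X. X \<in> Ob \<Longrightarrow> F X \<in> Ob'" "\<And>X. fst (F X) = fst X"
    and G: "\<And>Y. Y \<in> Ob' \<Longrightarrow> G Y \<in> Ob" "\<And>Y. fst (G Y) = fst Y"
    and GF: "\<And>X. X \<in> Ob \<Longrightarrow> G (F X) = X"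
    and FG: "\<And>Y. Y \<in> Ob' \<Longrightarrow> F (G Y) = Y"
    and Hom: "\<And>X Y. \<lbrakk>X \<in> Ob; Y \<in> Ob\<rbrakk> \<Longrightarrow> Hom' (F X) (F Y) = Hom X Y"
  shows "isomorphic_categories (mk_cat Ob Hom) (mk_cat Ob' Hom')"
proof -
  let ?Fa = "\<lambda>(X, f, Y). (F X, f, F Y)" and ?Ga = "\<lambda>(X, f, Y). (G X, f, G Y)"
  have "cat_functor (mk_cat Ob Hom) (mk_cat Ob' Hom') F ?Fa"
    by (rule cat_functor_mk_cat) (use assms in auto)
  moreover have "cat_functor (mk_cat Ob' Hom') (mk_cat Ob Hom) G ?Ga"
  proof (rule cat_functor_mk_cat)
    \<comment> \<open>Hom-sets are compared along \<open>F\<close> only; the comparison along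
      \<open>G\<close> follows by writing \<open>X\<close> and \<open>Y\<close> as
      \<open>F (G X)\<close> and \<open>F (G Y)\<close>.\<close>
    fix X Y assume "X \<in> Ob'" "Y \<in> Ob'"
    then show "Hom' X Y \<subseteq> Hom (G X) (G Y)"
      using Hom[of "G X" "G Y"] G FG by simp
  qed (use assms in auto)
  ultimately show ?thesis
    unfolding isomorphic_categories_def
    by (intro exI[of _ F] exI[of _ ?Fa] exI[of _ G] exI[of _ ?Ga])
      (auto simp: mk_cat_def GF FG)
qed

section \<open>Linear maps and endomorphisms\<close>

lemma lin_maps_compose:
  assumes "module R X" and "f \<in> lin_maps R X Y" and "g \<in> lin_maps R Y Z"
  shows "compose (carrier X) g f \<in> lin_maps R X Z"
proof -
  interpret X: module R X by fact
  show ?thesis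
    using assms(2,3) by (auto simp: lin_maps_def compose_def Pi_iff)
qed

lemma lin_maps_Id:
  assumes "module R X"
  shows "(\<lambda>x\<in>carrier X. x) \<in> lin_maps R X X"
proof -
  interpret X: module R X by fact
  show ?thesis
    by (auto simp: lin_maps_def)
qed

lemma lin_maps_minus:
  assumes "module R X" and "module R Y" and "f \<in> lin_maps R X Y"
    and "x \<in> carrier X" and "y \<in> carrier X"
  shows "f (x \<ominus>\<^bsub>X\<^esub> y) = f x \<ominus>\<^bsub>Y\<^esub> f y"
proof -
  interpret X: module R X by fact
  interpret Y: module R Y by fact
  have [simp]: "f x \<in> carrier Y" "f y \<in> carrier Y" "f (x \<ominus>\<^bsub>X\<^esub> y) \<in> carrier Y"
    using assms by (auto simp: lin_maps_def)
  \<comment> \<open>Linearity speaks of sums and scalars only, so \<open>f\<close> is applied to the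
    sum that gives back \<open>x\<close>, and \<open>f y\<close> is then cancelled in
    \<open>Y\<close>.\<close>
  have "f ((x \<ominus>\<^bsub>X\<^esub> y) \<oplus>\<^bsub>X\<^esub> y) = f (x \<ominus>\<^bsub>X\<^esub> y) \<oplus>\<^bsub>Y\<^esub> f y"
    using assms by (auto simp: lin_maps_def)
  moreover have "(x \<ominus>\<^bsub>X\<^esub> y) \<oplus>\<^bsub>X\<^esub> y = x"
    using assms by (simp add: X.minus_eq X.a_assoc X.l_neg)
  ultimately show ?thesis
    by (simp add: Y.minus_eq Y.a_assoc Y.r_neg)
qed

lemma (in module) smult_minus:
  assumes "a \<in> carrier R" and "x \<in> carrier M" and "y \<in> carrier M"
  shows "a \<odot>\<^bsub>M\<^esub> (x \<ominus>\<^bsub>M\<^esub> y) = a \<odot>\<^bsub>M\<^esub> x \<ominus>\<^bsub>M\<^esub> a \<odot>\<^bsub>M\<^esub> y"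
  using assms by (simp add: M.minus_eq smult_r_distr smult_r_minus)

lemma (in abelian_group) add_minus_add:
  assumes "a \<in> carrier G" "b \<in> carrier G" "c \<in> carrier G" "d \<in> carrier G"
  shows "(a \<oplus> b) \<ominus> (c \<oplus> d) = (a \<ominus> c) \<oplus> (b \<ominus> d)"
  using assms by (simp add: minus_eq minus_add a_ac)

text \<open>This exchange of the inner terms is the passage between the pre-Lie form of an identity,
  an equality of two associators, and its commutator form. Solving either equation for
  \<open>a\<close> gives the same sum.\<close>

lemma (in abelian_group) minus_eq_minus_swap:
  assumes "a \<in> carrier G" "b \<in> carrier G" "c \<in> carrier G" "d \<in> carrier G"
  shows "a \<ominus> b = c \<ominus> d \<longleftrightarrow> a \<ominus> c = b \<ominus> d"
proof -
  have "a = c \<ominus> d \<oplus> b \<longleftrightarrow> a = b \<ominus> d \<oplus> c"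
    using assms by (simp add: minus_eq a_ac)
  then show ?thesis
    using assms by (metis add.inv_solve_right minus_closed minus_eq)
qed

text \<open>Subtraction in \<open>End_alg R M\<close>, hence the bracket of \<open>gl R M\<close>,
  is defined through the abstract additive inverse, which can be computed only once the group laws
  are known. The inverse is pointwise negation.\<close>

lemma (in module) End_alg_abelian_group: "abelian_group (End_alg R M)"
proof (rule abelian_groupI)
  fix f assume f: "f \<in> carrier (End_alg R M)"
  have "(\<lambda>x\<in>carrier M. \<ominus>\<^bsub>M\<^esub> f x) \<in> carrier (End_alg R M)"
    using f by (auto simp: End_alg_def lin_maps_def Pi_iff M.minus_add smult_r_minus)
  moreover have "(\<lambda>x\<in>carrier M. \<ominus>\<^bsub>M\<^esub> f x) \<oplus>\<^bsub>End_alg R M\<^esub> f = \<zero>\<^bsub>End_alg R M\<^esub>"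
    using f by (auto simp: End_alg_def lin_maps_def Pi_iff M.l_neg)
  ultimately show "\<exists>g\<in>carrier (End_alg R M). g \<oplus>\<^bsub>End_alg R M\<^esub> f = \<zero>\<^bsub>End_alg R M\<^esub>"
    by blast
qed (auto simp: End_alg_def lin_maps_def Pi_iff smult_r_distr M.a_ac restrict_def
    extensional_def fun_eq_iff)

text \<open>Addition determines subtraction: the pointwise difference \<open>h\<close> is again
  linear, adding \<open>g\<close> to it gives \<open>f\<close>, and cancelling \<open>g\<close> in
  the group identifies it.\<close>

lemma (in module) End_alg_minus:
  assumes f: "f \<in> carrier (End_alg R M)" and g: "g \<in> carrier (End_alg R M)"
  shows "f \<ominus>\<^bsub>End_alg R M\<^esub> g = (\<lambda>x\<in>carrier M. f x \<ominus>\<^bsub>M\<^esub> g x)"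
proof -
  interpret E: abelian_group "End_alg R M" by (rule End_alg_abelian_group)
  define h where "h = (\<lambda>x\<in>carrier M. f x \<ominus>\<^bsub>M\<^esub> g x)"
  have h: "h \<in> carrier (End_alg R M)"
    using f g
    by (auto simp: h_def End_alg_def lin_maps_def Pi_iff smult_minus M.add_minus_add)
  have "h \<oplus>\<^bsub>End_alg R M\<^esub> g = f"
    using f g by (auto simp: h_def End_alg_def lin_maps_def Pi_iff extensional_def fun_eq_iff
        M.minus_eq M.a_assoc M.l_neg)
  then have "f \<ominus>\<^bsub>End_alg R M\<^esub> g = (h \<oplus>\<^bsub>End_alg R M\<^esub> g) \<ominus>\<^bsub>End_alg R M\<^esub> g"
    by simp
  also have "\<dots> = h"
    using g h by (simp add: E.minus_eq E.a_assoc E.r_neg)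
  finally show ?thesis
    by (simp only: h_def)
qed

lemma (in module) gl_mult:
  assumes "f \<in> carrier (End_alg R M)" and "g \<in> carrier (End_alg R M)"
  shows "f \<otimes>\<^bsub>gl R M\<^esub> g = (\<lambda>x\<in>carrier M. f (g x) \<ominus>\<^bsub>M\<^esub> g (f x))"
proof -
  \<comment> \<open>\<open>End_alg_minus\<close> speaks of members of the carrier, so composites are
    first shown to be endomorphisms.\<close>
  have "compose (carrier M) f g \<in> carrier (End_alg R M)"
    if "f \<in> carrier (End_alg R M)" "g \<in> carrier (End_alg R M)" for f g
    using that lin_maps_compose[OF module_axioms] by (auto simp: End_alg_def)
  then have "compose (carrier M) f g \<ominus>\<^bsub>End_alg R M\<^esub> compose (carrier M) g f =
      (\<lambda>x\<in>carrier M. compose (carrier M) f g x \<ominus>\<^bsub>M\<^esub> compose (carrier M) g f x)"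
    using assms by (intro End_alg_minus) auto
  then show ?thesis
    by (simp add: gl_def sub_adjacent_def) (auto simp: End_alg_def compose_def)
qed

section \<open>The sub-adjacent Lie algebra\<close>

lemma sub_adjacent_simps [simp]:
  "carrier (sub_adjacent A) = carrier A" "add (sub_adjacent A) = add A"
  "zero (sub_adjacent A) = zero A" "smult (sub_adjacent A) = smult A"
  "x \<otimes>\<^bsub>sub_adjacent A\<^esub> y = x \<otimes>\<^bsub>A\<^esub> y \<ominus>\<^bsub>A\<^esub> y \<otimes>\<^bsub>A\<^esub> x"
  by (simp_all add: sub_adjacent_def)

lemma lin_maps_sub_adjacent [simp]:
  "lin_maps R (sub_adjacent A) Y = lin_maps R A Y"
  "lin_maps R X (sub_adjacent A) = lin_maps R X A"
  by (simp_all add: lin_maps_def)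

text \<open>Passing to \<open>sub_adjacent A\<close> changes only the product, which no module axiom
  mentions.\<close>

lemma module_sub_adjacent: "module R (sub_adjacent A) \<longleftrightarrow> module R A"
  by (simp add: module_def module_axioms_def abelian_group_def abelian_monoid_def
      abelian_group_axioms_def)

context pre_lie_algebra
begin

lemma mult_lin_left: "y \<in> carrier A \<Longrightarrow> (\<lambda>x. x \<otimes>\<^bsub>A\<^esub> y) \<in> lin_maps R A A"
  and mult_lin_right: "x \<in> carrier A \<Longrightarrow> (\<lambda>y. x \<otimes>\<^bsub>A\<^esub> y) \<in> lin_maps R A A"
  using mult_bilin by (auto simp: bilin_map_def)

lemma mult_closed [simp]: "\<lbrakk>x \<in> carrier A; y \<in> carrier A\<rbrakk> \<Longrightarrow> x \<otimes>\<^bsub>A\<^esub> y \<in> carrier A"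
  using mult_lin_left[of y] by (auto simp: lin_maps_def)

lemma mult_minus_left:
  "\<lbrakk>x \<in> carrier A; y \<in> carrier A; z \<in> carrier A\<rbrakk>
    \<Longrightarrow> (x \<ominus>\<^bsub>A\<^esub> y) \<otimes>\<^bsub>A\<^esub> z = x \<otimes>\<^bsub>A\<^esub> z \<ominus>\<^bsub>A\<^esub> y \<otimes>\<^bsub>A\<^esub> z"
  using lin_maps_minus[OF module_axioms module_axioms mult_lin_left] by blast

lemma mult_minus_right:
  "\<lbrakk>x \<in> carrier A; y \<in> carrier A; z \<in> carrier A\<rbrakk>
    \<Longrightarrow> x \<otimes>\<^bsub>A\<^esub> (y \<ominus>\<^bsub>A\<^esub> z) = x \<otimes>\<^bsub>A\<^esub> y \<ominus>\<^bsub>A\<^esub> x \<otimes>\<^bsub>A\<^esub> z"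
  using lin_maps_minus[OF module_axioms module_axioms mult_lin_right] by blast

text \<open>The pre-Lie identity with its inner terms exchanged: left multiplication represents the
  commutator bracket on \<open>A\<close> itself. The Jacobi identity rests on this.\<close>

lemma bracket_mult:
  assumes "x \<in> carrier A" "y \<in> carrier A" "z \<in> carrier A"
  shows "(x \<otimes>\<^bsub>A\<^esub> y \<ominus>\<^bsub>A\<^esub> y \<otimes>\<^bsub>A\<^esub> x) \<otimes>\<^bsub>A\<^esub> z
    = x \<otimes>\<^bsub>A\<^esub> (y \<otimes>\<^bsub>A\<^esub> z) \<ominus>\<^bsub>A\<^esub> y \<otimes>\<^bsub>A\<^esub> (x \<otimes>\<^bsub>A\<^esub> z)"
  using pre_lie[OF assms] assms by (simp add: mult_minus_left M.minus_eq_minus_swap)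

lemma sub_adjacent_bilin:
  "bilin_map R (sub_adjacent A) (sub_adjacent A) (sub_adjacent A)
    (\<lambda>x y. x \<otimes>\<^bsub>sub_adjacent A\<^esub> y)"
  using mult_lin_left mult_lin_right
  by (auto simp: bilin_map_def lin_maps_def Pi_iff M.add_minus_add smult_minus)

lemma jacobi_sub_adjacent:
  assumes [simp]: "x \<in> carrier A" "y \<in> carrier A" "z \<in> carrier A"
  defines "br \<equiv> \<lambda>x y. x \<otimes>\<^bsub>A\<^esub> y \<ominus>\<^bsub>A\<^esub> y \<otimes>\<^bsub>A\<^esub> x"
  shows "br x (br y z) \<oplus>\<^bsub>A\<^esub> br y (br z x) \<oplus>\<^bsub>A\<^esub> br z (br x y) = \<zero>\<^bsub>A\<^esub>"
proof -
  \<comment> \<open>After expansion by \<open>bracket_mult\<close> and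
    \<open>mult_minus_right\<close>, the letters \<open>a\<close> to \<open>f\<close> stand for the
    products \<open>x(yz)\<close>, \<open>x(zy)\<close>, \<open>y(zx)\<close>, \<open>z(yx)\<close>,
    \<open>y(xz)\<close>, \<open>z(xy)\<close>. Each occurs once with each sign.\<close>
  have cancel: "((a \<ominus>\<^bsub>A\<^esub> b) \<ominus>\<^bsub>A\<^esub> (c \<ominus>\<^bsub>A\<^esub> d)) \<oplus>\<^bsub>A\<^esub> ((c \<ominus>\<^bsub>A\<^esub> e) \<ominus>\<^bsub>A\<^esub> (f \<ominus>\<^bsub>A\<^esub> b))
      \<oplus>\<^bsub>A\<^esub> ((f \<ominus>\<^bsub>A\<^esub> d) \<ominus>\<^bsub>A\<^esub> (a \<ominus>\<^bsub>A\<^esub> e)) = \<zero>\<^bsub>A\<^esub>"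
    if "a \<in> carrier A" "b \<in> carrier A" "c \<in> carrier A" "d \<in> carrier A" "e \<in> carrier A" "f \<in> carrier A"
    for a b c d e f
  proof -
    have step: "(a \<ominus>\<^bsub>A\<^esub> b) \<ominus>\<^bsub>A\<^esub> (c \<ominus>\<^bsub>A\<^esub> d) = (a \<oplus>\<^bsub>A\<^esub> d) \<ominus>\<^bsub>A\<^esub> (b \<oplus>\<^bsub>A\<^esub> c)"
      if "a \<in> carrier A" "b \<in> carrier A" "c \<in> carrier A" "d \<in> carrier A" for a b c d
      using that by (simp add: M.minus_eq M.minus_add M.a_ac)
    have "(a \<oplus>\<^bsub>A\<^esub> d) \<oplus>\<^bsub>A\<^esub> (c \<oplus>\<^bsub>A\<^esub> b) \<oplus>\<^bsub>A\<^esub> (f \<oplus>\<^bsub>A\<^esub> e)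
        = (b \<oplus>\<^bsub>A\<^esub> c) \<oplus>\<^bsub>A\<^esub> (e \<oplus>\<^bsub>A\<^esub> f) \<oplus>\<^bsub>A\<^esub> (d \<oplus>\<^bsub>A\<^esub> a)"
      using that by (simp add: M.a_ac)
    then show ?thesis
      using that by (simp add: step M.add_minus_add[symmetric]) (simp add: M.minus_eq M.r_neg)
  qed
  show ?thesis
    unfolding br_def
    by (simp add: bracket_mult mult_minus_right cancel)
qed

lemma lie_algebra_sub_adjacent: "lie_algebra R (sub_adjacent A)"
proof -
  interpret L: module R "sub_adjacent A"
    using module_axioms by (simp add: module_sub_adjacent)
  show ?thesis
    by unfold_locales
      (use jacobi_sub_adjacent sub_adjacent_bilin in \<open>auto simp: M.minus_eq M.r_neg\<close>)
qed

section \<open>Currying the action\<close>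

text \<open>Relating \<open>\<rho>\<close> and \<open>act\<close> by an equation on the carrier
  serves both currying a given \<open>act\<close> and uncurrying a given \<open>\<rho>\<close>.
  Values of \<open>\<rho>\<close> in the endomorphisms encode linearity in \<open>m\<close>,
  linearity of \<open>\<rho>\<close> encodes linearity in the algebra argument, and the bracket
  condition is the module identity rearranged.\<close>

lemma rep_hom_iff:
  assumes M: "module R M"
    and \<rho>: "\<And>x. x \<in> carrier A \<Longrightarrow> \<rho> x = (\<lambda>m\<in>carrier M. act (x, m))"
  shows "\<rho> \<in> lie_hom R (sub_adjacent A) (gl R M) \<longleftrightarrow> pre_lie_module R A M act"
proof -
  interpret M': module R M by fact
  have lin: "(\<forall>x\<in>carrier A. \<rho> x \<in> carrier (End_alg R M)) \<longleftrightarrow>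
      (\<forall>x\<in>carrier A. (\<lambda>m. act (x, m)) \<in> lin_maps R M M)"
    by (auto simp: \<rho> End_alg_def lin_maps_def Pi_iff)
  have bilin: "\<rho> \<in> lin_maps R A (gl R M) \<longleftrightarrow> bilin_map R A M M (\<lambda>x m. act (x, m))"
    by (auto simp: gl_def \<rho> End_alg_def lin_maps_def bilin_map_def Pi_iff
        restrict_def extensional_def fun_eq_iff)
  \<comment> \<open>Bilinearity is assumed here because it keeps all terms in \<open>M\<close>,
    where they may be rearranged, and lets \<open>act\<close> distribute over the bracket.\<close>
  have compat: "\<rho> (x \<otimes>\<^bsub>sub_adjacent A\<^esub> y) = \<rho> x \<otimes>\<^bsub>gl R M\<^esub> \<rho> y \<longleftrightarrow>
      (\<forall>m\<in>carrier M. act (x \<otimes>\<^bsub>A\<^esub> y, m) \<ominus>\<^bsub>M\<^esub> act (x, act (y, m)) =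
        act (y \<otimes>\<^bsub>A\<^esub> x, m) \<ominus>\<^bsub>M\<^esub> act (y, act (x, m)))"
    if b: "bilin_map R A M M (\<lambda>x m. act (x, m))" and x: "x \<in> carrier A" and y: "y \<in> carrier A"
    for x y
  proof -
    have E: "\<rho> x \<in> carrier (End_alg R M)" "\<rho> y \<in> carrier (End_alg R M)"
      using lin b x y by (auto simp: bilin_map_def)
    have cl: "act (z, m) \<in> carrier M" if "z \<in> carrier A" "m \<in> carrier M" for z m
      using b that by (auto simp: bilin_map_def lin_maps_def)
    have minus: "act (x \<otimes>\<^bsub>A\<^esub> y \<ominus>\<^bsub>A\<^esub> y \<otimes>\<^bsub>A\<^esub> x, m)
        = act (x \<otimes>\<^bsub>A\<^esub> y, m) \<ominus>\<^bsub>M\<^esub> act (y \<otimes>\<^bsub>A\<^esub> x, m)" if "m \<in> carrier M" for m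
      using lin_maps_minus[OF module_axioms M, of "\<lambda>z. act (z, m)"] b x y that
      by (simp add: bilin_map_def)
    \<comment> \<open>Each inner value lies in the carrier by \<open>cl\<close>, so the outer
      restricted map evaluates to \<open>act\<close>.\<close>
    have prod: "\<rho> x \<otimes>\<^bsub>gl R M\<^esub> \<rho> y
        = (\<lambda>m\<in>carrier M. act (x, act (y, m)) \<ominus>\<^bsub>M\<^esub> act (y, act (x, m)))"
      unfolding M'.gl_mult[OF E] using x y by (intro restrict_ext) (simp add: \<rho> cl)
    have "\<rho> (x \<otimes>\<^bsub>sub_adjacent A\<^esub> y) = \<rho> x \<otimes>\<^bsub>gl R M\<^esub> \<rho> y \<longleftrightarrow>
      (\<forall>m\<in>carrier M. act (x \<otimes>\<^bsub>A\<^esub> y, m) \<ominus>\<^bsub>M\<^esub> act (y \<otimes>\<^bsub>A\<^esub> x, m) =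
        act (x, act (y, m)) \<ominus>\<^bsub>M\<^esub> act (y, act (x, m)))"
      unfolding prod using x y by (auto simp: \<rho> minus restrict_def fun_eq_iff)
    then show ?thesis
      using x y by (simp add: cl M'.M.minus_eq_minus_swap)
  qed
  have "pre_lie_module R A M act \<longleftrightarrow> bilin_map R A M M (\<lambda>x m. act (x, m)) \<and>
      (\<forall>x\<in>carrier A. \<forall>y\<in>carrier A. \<forall>m\<in>carrier M.
        act (x \<otimes>\<^bsub>A\<^esub> y, m) \<ominus>\<^bsub>M\<^esub> act (x, act (y, m)) =
        act (y \<otimes>\<^bsub>A\<^esub> x, m) \<ominus>\<^bsub>M\<^esub> act (y, act (x, m)))"
    using M pre_lie_algebra_axioms
    by (auto simp: pre_lie_module_def pre_lie_module_axioms_def)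
  \<comment> \<open>The bracket stays folded so that the goal matches the left side of
    \<open>compat\<close>.\<close>
  then show ?thesis
    unfolding lie_hom_def using bilin compat by (auto simp del: sub_adjacent_simps(5))
qed

lemma lie_module_iff:
  assumes "module R M" and "\<And>x. x \<in> carrier A \<Longrightarrow> \<rho> x = (\<lambda>m\<in>carrier M. act (x, m))"
  shows "lie_module R (sub_adjacent A) M \<rho> \<longleftrightarrow> pre_lie_module R A M act"
  using rep_hom_iff[OF assms] assms(1) lie_algebra_sub_adjacent
  by (auto simp: lie_module_def lie_module_axioms_def)

end

section \<open>The two module categories\<close>

lemma pre_lie_modules_act_closed:
  assumes "(M, act) \<in> pre_lie_modules R A" and "x \<in> carrier A" and "m \<in> carrier M"
  shows "act (x, m) \<in> carrier M"
  using assms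
  by (auto simp: pre_lie_modules_def pre_lie_module_def pre_lie_module_axioms_def
      bilin_map_def lin_maps_def)

text \<open>The restricted identity and composite agree with the plain maps only on the carrier, so
  their compatibility with the action uses that \<open>act (x, m)\<close> stays there.\<close>

lemma category_pre_lie_module_cat: "category (pre_lie_module_cat R A)"
  unfolding pre_lie_module_cat_def
proof (rule category_mk_cat)
  show "pre_lie_module_homs R A X Y
      \<subseteq> (carrier (fst X) \<rightarrow> carrier (fst Y)) \<inter> extensional (carrier (fst X))" for X Y
    by (auto simp: pre_lie_module_homs_def lin_maps_def split: prod.splits)
next
  fix X assume X: "X \<in> pre_lie_modules R A"
  obtain M act where [simp]: "X = (M, act)" by force
  have "act (x, m) \<in> carrier M" if "x \<in> carrier A" "m \<in> carrier M" for x m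
    using X that by (auto intro: pre_lie_modules_act_closed)
  then show "(\<lambda>m\<in>carrier (fst X). m) \<in> pre_lie_module_homs R A X X"
    using X by (auto simp: pre_lie_module_homs_def pre_lie_modules_def k_modules_def lin_maps_Id)
next
  fix X Y Z f g
  assume X: "X \<in> pre_lie_modules R A" and fg: "f \<in> pre_lie_module_homs R A X Y"
    "g \<in> pre_lie_module_homs R A Y Z"
  obtain M act where [simp]: "X = (M, act)" by force
  have "act (x, m) \<in> carrier M" if "x \<in> carrier A" "m \<in> carrier M" for x m
    using X that by (auto intro: pre_lie_modules_act_closed)
  moreover have "f \<in> lin_maps R M (fst Y)" "g \<in> lin_maps R (fst Y) (fst Z)"
    using fg by (auto simp: pre_lie_module_homs_def split: prod.splits)
  moreover from this have "compose (carrier M) g f \<in> lin_maps R M (fst Z)"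
    using X by (intro lin_maps_compose) (auto simp: pre_lie_modules_def k_modules_def)
  moreover have "f \<in> carrier M \<rightarrow> carrier (fst Y)"
    using \<open>f \<in> lin_maps R M (fst Y)\<close> by (simp add: lin_maps_def)
  ultimately show "compose (carrier (fst X)) g f \<in> pre_lie_module_homs R A X Z"
    using fg by (auto simp: pre_lie_module_homs_def compose_def Pi_iff split: prod.splits)
qed

lemma lie_modules_rep_closed:
  assumes "(M, \<rho>) \<in> lie_modules R L" and "x \<in> carrier L" and "m \<in> carrier M"
  shows "\<rho> x m \<in> carrier M"
  using assms
  by (auto simp: lie_modules_def lie_module_def lie_module_axioms_def
      lie_hom_def gl_def End_alg_def lin_maps_def)

lemma category_lie_module_cat: "category (lie_module_cat R L)"
  unfolding lie_module_cat_def
proof (rule category_mk_cat)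
  show "lie_module_homs R L X Y
      \<subseteq> (carrier (fst X) \<rightarrow> carrier (fst Y)) \<inter> extensional (carrier (fst X))" for X Y
    by (auto simp: lie_module_homs_def lin_maps_def split: prod.splits)
next
  fix X assume X: "X \<in> lie_modules R L"
  obtain M \<rho> where [simp]: "X = (M, \<rho>)" by force
  have "\<rho> x m \<in> carrier M" if "x \<in> carrier L" "m \<in> carrier M" for x m
    using X that by (auto intro: lie_modules_rep_closed)
  then show "(\<lambda>m\<in>carrier (fst X). m) \<in> lie_module_homs R L X X"
    using X by (auto simp: lie_module_homs_def lie_modules_def k_modules_def lin_maps_Id)
next
  fix X Y Z f g
  assume X: "X \<in> lie_modules R L" and fg: "f \<in> lie_module_homs R L X Y"
    "g \<in> lie_module_homs R L Y Z"
  obtain M \<rho> where [simp]: "X = (M, \<rho>)" by force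
  have "\<rho> x m \<in> carrier M" if "x \<in> carrier L" "m \<in> carrier M" for x m
    using X that by (auto intro: lie_modules_rep_closed)
  moreover have "f \<in> lin_maps R M (fst Y)" "g \<in> lin_maps R (fst Y) (fst Z)"
    using fg by (auto simp: lie_module_homs_def split: prod.splits)
  moreover from this have "compose (carrier M) g f \<in> lin_maps R M (fst Z)"
    using X by (intro lin_maps_compose) (auto simp: lie_modules_def k_modules_def)
  moreover have "f \<in> carrier M \<rightarrow> carrier (fst Y)"
    using \<open>f \<in> lin_maps R M (fst Y)\<close> by (simp add: lin_maps_def)
  ultimately show "compose (carrier (fst X)) g f \<in> lie_module_homs R L X Z"
    using fg by (auto simp: lie_module_homs_def compose_def Pi_iff split: prod.splits)
qed

section \<open>Isomorphism of the categories by currying\<close>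

theorem theorem9:
  fixes R :: "('k, 'r) ring_scheme" and A :: "('k, 'a, 's) module_scheme"
  assumes "cring R" and "pre_lie_algebra R A"
  shows "isomorphic_categories
    (pre_lie_module_cat R A
      :: (('k, 'a, 'm) pl_obj, (('k, 'a, 'm) pl_obj, 'm) arrow) cat)
    (lie_module_cat R (sub_adjacent A)
      :: (('k, 'a, 'm) lie_obj, (('k, 'a, 'm) lie_obj, 'm) arrow) cat)"
proof -
  interpret pre_lie_algebra R A by fact
  \<comment> \<open>The restrictions in \<open>F\<close> and \<open>G\<close> reproduce the
    extensionality required of objects, so that the round trips are equalities of functions and not
    merely agreement on carriers.\<close>
  define F :: "('k, 'a, 'm) pl_obj \<Rightarrow> ('k, 'a, 'm) lie_obj" where
    "F = (\<lambda>(M, act). (M, \<lambda>x\<in>carrier A. \<lambda>m\<in>carrier M. act (x, m)))"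
  define G :: "('k, 'a, 'm) lie_obj \<Rightarrow> ('k, 'a, 'm) pl_obj" where
    "G = (\<lambda>(M, \<rho>). (M, \<lambda>(x, m)\<in>carrier A \<times> carrier M. \<rho> x m))"
  \<comment> \<open>Each \<open>\<rho> x\<close> belongs to \<open>End_alg R M\<close>, whose
    elements are extensional. Hence restricting it again, as uncurrying and currying do, gives back
    \<open>\<rho> x\<close>.\<close>
  have ext: "\<rho> x \<in> extensional (carrier M)"
    if "(M, \<rho>) \<in> lie_modules R (sub_adjacent A)" "x \<in> carrier A" for M :: "('k, 'm) module" and \<rho> x
    using that by (auto simp: lie_modules_def lie_module_def lie_module_axioms_def lie_hom_def
        gl_def End_alg_def lin_maps_def)
  have F: "F X \<in> lie_modules R (sub_adjacent A)" if "X \<in> pre_lie_modules R A" for X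
    using that
    by (auto simp: F_def pre_lie_modules_def lie_modules_def k_modules_def
        intro!: lie_module_iff[THEN iffD2])
  have G: "G Y \<in> pre_lie_modules R A" if Y: "Y \<in> lie_modules R (sub_adjacent A)" for Y
  proof -
    obtain M \<rho> where [simp]: "Y = (M, \<rho>)" by force
    have "\<rho> x = (\<lambda>m\<in>carrier M. (\<lambda>(x, m)\<in>carrier A \<times> carrier M. \<rho> x m) (x, m))"
      if "x \<in> carrier A" for x
      using ext[of M \<rho> x] Y that by (auto simp: extensional_def fun_eq_iff)
    from lie_module_iff[of M \<rho> "\<lambda>(x, m)\<in>carrier A \<times> carrier M. \<rho> x m", OF _ this] Y show ?thesis
      by (auto simp: G_def pre_lie_modules_def lie_modules_def k_modules_def)
  qed
  have GF: "G (F X) = X" if "X \<in> pre_lie_modules R A" for X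
    using that by (auto simp: F_def G_def pre_lie_modules_def extensional_def fun_eq_iff)
  have FG: "F (G Y) = Y" if "Y \<in> lie_modules R (sub_adjacent A)" for Y
    using that ext[of "fst Y" "snd Y"]
    by (cases Y) (auto simp: F_def G_def lie_modules_def extensional_def fun_eq_iff)
  \<comment> \<open>Compatibility is tested at \<open>m\<close> in the source carrier, and linearity
    puts \<open>f m\<close> in the target carrier, so the restrictions introduced by
    \<open>F\<close> disappear on both sides.\<close>
  have Hom: "lie_module_homs R (sub_adjacent A) (F X) (F Y) = pre_lie_module_homs R A X Y" for X Y
    by (cases X; cases Y)
      (auto simp: F_def lie_module_homs_def pre_lie_module_homs_def lin_maps_def Pi_iff)
  show ?thesis
    using category_pre_lie_module_cat category_lie_module_cat
    unfolding pre_lie_module_cat_def lie_module_cat_def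
    by (rule isomorphic_categories_mk_cat[where F = F and G = G])
      (use F G GF FG Hom in \<open>auto simp: F_def G_def split: prod.splits\<close>)
qed

end
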